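(* Let $\psi(\vec x,y,\vec z)\in L$ and $M\models PA$. Then $$M\models\forall\vec x,y\Big(\forall i\le y\,\exists!\vec z\ \psi(\vec x,i,\vec z)\ \rightarrow\ \exists w\,\forall i\le y\,\forall\vec z\,\big(\psi(\vec x,i,\vec z)\rightarrow\overline{(w)_i}=\vec z\big)\Big).$$
   Context: $L$ is the first-order language with equality and signature $\{+,\cdot,<,0,1\}$ of Peano arithmetic $PA$. All models considered are countable. Vectors are finite tuples of variables (of standard length); equality of vectors is componentwise. Coding functions (definable in $PA$): $\langle x,y\rangle=\lfloor (x+y+1)(x+y)/2\rfloor+y$, and $L(z),R(z)$ are its inverses: $L(\langle x,y\rangle)=x$, $R(\langle x,y\rangle)=y$, $\langle L(z),R(z)\rangle=z$. Put $\langle x_1,\dots,x_n\rangle=\langle x_1,\langle x_2,\dots,x_n\rangle\rangle$, and let $\overline z$ be the $n$-tuple coded by $z$ ($\overline z=z$ if $n=1$), where here $n$ is the length of $\vec z$. The extended $\beta$-function $(x)_i$ is the remainder of $L(x)$ on division by $R(x)\cdot(i+1)+1$. *)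

theory Defs
  imports "HOL-Library.Countable_Set"
begin

section \<open>The language of Peano arithmetic\<close>

text \<open>Variables are de Bruijn indices: in \<open>All p\<close> and \<open>Ex p\<close> the bound variable is \<open>Var 0\<close>.\<close>

datatype tm = Var nat | Zero | One | Add tm tm | Mul tm tm

datatype fm =
    Eq tm tm | Less tm tm
  | Neg fm | And fm fm | Or fm fm | Imp fm fm
  | All fm | Ex fm

primrec fv_tm :: "tm \<Rightarrow> nat set" where
  "fv_tm (Var k) = {k}"
| "fv_tm Zero = {}"
| "fv_tm One = {}"
| "fv_tm (Add s t) = fv_tm s \<union> fv_tm t"
| "fv_tm (Mul s t) = fv_tm s \<union> fv_tm t"

primrec fv :: "fm \<Rightarrow> nat set" where
  "fv (Eq s t) = fv_tm s \<union> fv_tm t"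
| "fv (Less s t) = fv_tm s \<union> fv_tm t"
| "fv (Neg p) = fv p"
| "fv (And p q) = fv p \<union> fv q"
| "fv (Or p q) = fv p \<union> fv q"
| "fv (Imp p q) = fv p \<union> fv q"
| "fv (All p) = {k. Suc k \<in> fv p}"
| "fv (Ex p) = {k. Suc k \<in> fv p}"

text \<open>Simultaneous capture-avoiding substitution.\<close>

primrec subst_tm :: "(nat \<Rightarrow> tm) \<Rightarrow> tm \<Rightarrow> tm" where
  "subst_tm \<sigma> (Var k) = \<sigma> k"
| "subst_tm \<sigma> Zero = Zero"
| "subst_tm \<sigma> One = One"
| "subst_tm \<sigma> (Add s t) = Add (subst_tm \<sigma> s) (subst_tm \<sigma> t)"
| "subst_tm \<sigma> (Mul s t) = Mul (subst_tm \<sigma> s) (subst_tm \<sigma> t)"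

definition lift :: "tm \<Rightarrow> tm" where
  "lift = subst_tm (\<lambda>k. Var (Suc k))"

definition up :: "(nat \<Rightarrow> tm) \<Rightarrow> nat \<Rightarrow> tm" where
  "up \<sigma> = case_nat (Var 0) (\<lambda>k. lift (\<sigma> k))"

primrec subst :: "(nat \<Rightarrow> tm) \<Rightarrow> fm \<Rightarrow> fm" where
  "subst \<sigma> (Eq s t) = Eq (subst_tm \<sigma> s) (subst_tm \<sigma> t)"
| "subst \<sigma> (Less s t) = Less (subst_tm \<sigma> s) (subst_tm \<sigma> t)"
| "subst \<sigma> (Neg p) = Neg (subst \<sigma> p)"
| "subst \<sigma> (And p q) = And (subst \<sigma> p) (subst \<sigma> q)"
| "subst \<sigma> (Or p q) = Or (subst \<sigma> p) (subst \<sigma> q)"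
| "subst \<sigma> (Imp p q) = Imp (subst \<sigma> p) (subst \<sigma> q)"
| "subst \<sigma> (All p) = All (subst (up \<sigma>) p)"
| "subst \<sigma> (Ex p) = Ex (subst (up \<sigma>) p)"

section \<open>Structures and satisfaction\<close>

text \<open>The universe of a structure is the whole (nonempty) type \<open>'a\<close>.\<close>

record 'a struc =
  zero_of :: 'a
  one_of :: 'a
  add_of :: "'a \<Rightarrow> 'a \<Rightarrow> 'a"
  mul_of :: "'a \<Rightarrow> 'a \<Rightarrow> 'a"
  less_of :: "'a \<Rightarrow> 'a \<Rightarrow> bool"

primrec val :: "'a struc \<Rightarrow> (nat \<Rightarrow> 'a) \<Rightarrow> tm \<Rightarrow> 'a" where
  "val M e (Var k) = e k"
| "val M e Zero = zero_of M"
| "val M e One = one_of M"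
| "val M e (Add s t) = add_of M (val M e s) (val M e t)"
| "val M e (Mul s t) = mul_of M (val M e s) (val M e t)"

primrec sat :: "'a struc \<Rightarrow> (nat \<Rightarrow> 'a) \<Rightarrow> fm \<Rightarrow> bool" where
  "sat M e (Eq s t) \<longleftrightarrow> val M e s = val M e t"
| "sat M e (Less s t) \<longleftrightarrow> less_of M (val M e s) (val M e t)"
| "sat M e (Neg p) \<longleftrightarrow> \<not> sat M e p"
| "sat M e (And p q) \<longleftrightarrow> sat M e p \<and> sat M e q"
| "sat M e (Or p q) \<longleftrightarrow> sat M e p \<or> sat M e q"
| "sat M e (Imp p q) \<longleftrightarrow> (sat M e p \<longrightarrow> sat M e q)"
| "sat M e (All p) \<longleftrightarrow> (\<forall>a. sat M (case_nat a e) p)"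
| "sat M e (Ex p) \<longleftrightarrow> (\<exists>a. sat M (case_nat a e) p)"

text \<open>A formula with free variables holds in \<open>M\<close> iff its universal closure does.\<close>

definition holds :: "'a struc \<Rightarrow> fm \<Rightarrow> bool"  (infix "\<Turnstile>" 50) where
  "M \<Turnstile> p \<longleftrightarrow> (\<forall>e. sat M e p)"

definition models :: "'a struc \<Rightarrow> fm set \<Rightarrow> bool"  (infix "\<Turnstile>*" 50) where
  "M \<Turnstile>* T \<longleftrightarrow> (\<forall>p\<in>T. M \<Turnstile> p)"

section \<open>Peano arithmetic\<close>

definition Le :: "tm \<Rightarrow> tm \<Rightarrow> fm" where
  "Le s t = Or (Less s t) (Eq s t)"

text \<open>The theory of the nonnegative parts of discretely ordered rings (Kaye's \<open>PA\<^sup>-\<close>);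
  free variables are read universally.\<close>

definition PA_minus :: "fm set" where
  "PA_minus =
    (let x = Var 0; y = Var 1; z = Var 2 in
    { Eq (Add (Add x y) z) (Add x (Add y z)),
      Eq (Add x y) (Add y x),
      Eq (Mul (Mul x y) z) (Mul x (Mul y z)),
      Eq (Mul x y) (Mul y x),
      Eq (Mul x (Add y z)) (Add (Mul x y) (Mul x z)),
      Eq (Add x Zero) x,
      Eq (Mul x Zero) Zero,
      Eq (Mul x One) x,
      Imp (And (Less x y) (Less y z)) (Less x z),
      Neg (Less x x),
      Or (Less x y) (Or (Eq x y) (Less y x)),
      Imp (Less x y) (Less (Add x z) (Add y z)),
      Imp (And (Less Zero z) (Less x y)) (Less (Mul x z) (Mul y z)),
      Imp (Less x y) (Ex (Eq (Add (lift x) (Var 0)) (lift y))),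
      Less Zero One,
      Imp (Less Zero x) (Le One x),
      Le Zero x })"

text \<open>Induction on \<open>Var 0\<close>; the other free variables of \<open>p\<close> are parameters.\<close>

definition induction_ax :: "fm \<Rightarrow> fm" where
  "induction_ax p =
    Imp (And (subst (case_nat Zero Var) p)
             (All (Imp p (subst (Var(0 := Add (Var 0) One)) p))))
        (All p)"

definition PA :: "fm set" where
  "PA = PA_minus \<union> range induction_ax"

section \<open>Coding\<close>

text \<open>The coding functions are not symbols of the language; each is represented by an
  \<open>L\<close>-formula defining its graph, the value being the last argument.\<close>

text \<open>\<open>v = \<lfloor>s/2\<rfloor>\<close>\<close>
definition half_fm :: "tm \<Rightarrow> tm \<Rightarrow> fm" where
  "half_fm s v = Or (Eq (Add v v) s) (Eq (Add (Add v v) One) s)"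

text \<open>\<open>z = \<langle>x,y\<rangle> = \<lfloor>(x+y+1)(x+y)/2\<rfloor> + y\<close>\<close>
definition pair_fm :: "tm \<Rightarrow> tm \<Rightarrow> tm \<Rightarrow> fm" where
  "pair_fm x y z =
    (let x' = lift x; y' = lift y; z' = lift z; h = Var 0 in
     Ex (And (half_fm (Mul (Add (Add x' y') One) (Add x' y')) h)
             (Eq z' (Add h y'))))"

definition L_fm :: "tm \<Rightarrow> tm \<Rightarrow> fm" where
  "L_fm z x = Ex (pair_fm (lift x) (Var 0) (lift z))"

definition R_fm :: "tm \<Rightarrow> tm \<Rightarrow> fm" where
  "R_fm z y = Ex (pair_fm (Var 0) (lift y) (lift z))"

text \<open>\<open>r\<close> is the remainder of \<open>a\<close> on division by \<open>b\<close>\<close>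
definition rem_fm :: "tm \<Rightarrow> tm \<Rightarrow> tm \<Rightarrow> fm" where
  "rem_fm a b r =
    And (Less r b) (Ex (Eq (lift a) (Add (Mul (lift b) (Var 0)) (lift r))))"

text \<open>\<open>v = (w)\<^sub>i\<close>\<close>
definition beta_fm :: "tm \<Rightarrow> tm \<Rightarrow> tm \<Rightarrow> fm" where
  "beta_fm w i v =
    (let w' = lift (lift w); i' = lift (lift i); v' = lift (lift v);
         l = Var 1; r = Var 0 in
     Ex (Ex (And (L_fm w' l) (And (R_fm w' r)
       (rem_fm l (Add (Mul r (Add i' One)) One) v')))))"

text \<open>\<open>v = \<langle>z\<^sub>1,\<dots>,z\<^sub>n\<rangle>\<close>, that is, \<open>z\<^sub>1,\<dots>,z\<^sub>n\<close> is the \<open>n\<close>-tuple coded by \<open>v\<close>. Tuples are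
  nonempty; the first equation only makes the function total.\<close>
fun tuple_fm :: "tm list \<Rightarrow> tm \<Rightarrow> fm" where
  "tuple_fm [] v = Eq v v"
| "tuple_fm [z] v = Eq v z"
| "tuple_fm (z # zs) v =
    Ex (And (tuple_fm (map lift zs) (Var 0)) (pair_fm (lift z) (Var 0) (lift v)))"

text \<open>\<open>z\<^sub>1,\<dots>,z\<^sub>n\<close> is the tuple coded by \<open>(w)\<^sub>i\<close>\<close>
definition decode_fm :: "tm \<Rightarrow> tm \<Rightarrow> tm list \<Rightarrow> fm" where
  "decode_fm w i zs =
    Ex (And (beta_fm (lift w) (lift i) (Var 0)) (tuple_fm (map lift zs) (Var 0)))"

section \<open>The coding sentence\<close>

definition Alls :: "nat \<Rightarrow> fm \<Rightarrow> fm" where "Alls n p = (All ^^ n) p"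
definition Exs :: "nat \<Rightarrow> fm \<Rightarrow> fm" where "Exs n p = (Ex ^^ n) p"

text \<open>The variables bound by a block of \<open>n\<close> quantifiers, outermost first, seen from below
  \<open>b\<close> further quantifiers.\<close>

definition block :: "nat \<Rightarrow> nat \<Rightarrow> tm list" where
  "block b n = map Var (rev [b..<b + n])"

text \<open>The free variables of \<open>\<psi>(x\<^sub>1,\<dots>,x\<^sub>m,y,z\<^sub>1,\<dots>,z\<^sub>n)\<close> are \<open>Var 0, \<dots>, Var (m + n)\<close> in this
  order; \<open>inst \<psi> [s\<^sub>1,\<dots>,s\<^sub>m] t [u\<^sub>1,\<dots>,u\<^sub>n]\<close> substitutes terms for them.\<close>

definition inst :: "fm \<Rightarrow> tm list \<Rightarrow> tm \<Rightarrow> tm list \<Rightarrow> fm" where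
  "inst \<psi> xs y zs = subst (\<lambda>k. (xs @ y # zs) ! k) \<psi>"

definition vec_eq :: "tm list \<Rightarrow> tm list \<Rightarrow> fm" where
  "vec_eq ss ts = foldr And (map2 Eq ss ts) (Eq Zero Zero)"

text \<open>The sentence \<open>\<forall>x\<^sub>1\<dots>x\<^sub>m,y (\<forall>i\<le>y \<exists>!z\<^sub>1\<dots>z\<^sub>n \<psi>(x,i,z) \<longrightarrow> \<exists>w \<forall>i\<le>y \<forall>z\<^sub>1\<dots>z\<^sub>n (\<psi>(x,i,z) \<longrightarrow> \<theta>))\<close>, where
  \<open>\<theta>\<close> says that the tuple coded by \<open>(w)\<^sub>i\<close> is \<open>z\<^sub>1,\<dots>,z\<^sub>n\<close>, and
  \<open>\<exists>!z \<phi>(z)\<close> is \<open>\<exists>z (\<phi>(z) \<and> \<forall>z' (\<phi>(z') \<longrightarrow> z' = z))\<close>. Its meaning in a structure is spelled out in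
  \<open>holds_coding_sentence\<close> below.\<close>

definition coding_sentence :: "nat \<Rightarrow> nat \<Rightarrow> fm \<Rightarrow> fm" where
  "coding_sentence m n \<psi> =
    Alls m (All (Imp
      (All (Imp (Le (Var 0) (Var 1))
        (Exs n (And
          (inst \<psi> (block (n + 2) m) (Var n) (block 0 n))
          (Alls n (Imp
            (inst \<psi> (block (2 * n + 2) m) (Var (2 * n)) (block 0 n))
            (vec_eq (block 0 n) (block n n))))))))
      (Ex (All (Imp (Le (Var 0) (Var 2))
        (Alls n (Imp
          (inst \<psi> (block (n + 3) m) (Var n) (block 0 n))
          (decode_fm (Var (n + 1)) (Var n) (block 0 n)))))))))"

section \<open>Semantics of the coding sentence\<close>

lemma val_lift [simp]: "val M (case_nat a e) (lift t) = val M e t"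
  unfolding lift_def by (induction t) auto

lemma val_subst: "val M e (subst_tm \<sigma> t) = val M (\<lambda>k. val M e (\<sigma> k)) t"
  by (induction t) auto

lemma val_up: "(\<lambda>k. val M (case_nat a e) (up \<sigma> k)) = case_nat a (\<lambda>k. val M e (\<sigma> k))"
  by (auto simp: up_def fun_eq_iff split: nat.split)

lemma sat_subst: "sat M e (subst \<sigma> p) \<longleftrightarrow> sat M (\<lambda>k. val M e (\<sigma> k)) p"
  by (induction p arbitrary: \<sigma> e) (auto simp: val_subst val_up)

lemma val_cong: "(\<And>k. k \<in> fv_tm t \<Longrightarrow> e k = e' k) \<Longrightarrow> val M e t = val M e' t"
  by (induction t) auto

lemma sat_cong: "(\<And>k. k \<in> fv p \<Longrightarrow> e k = e' k) \<Longrightarrow> sat M e p \<longleftrightarrow> sat M e' p"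
proof (induction p arbitrary: e e')
  case (Eq s t)
  have "val M e s = val M e' s" "val M e t = val M e' t"
    by (rule val_cong, rule Eq, simp)+
  then show ?case by simp
next
  case (Less s t)
  have "val M e s = val M e' s" "val M e t = val M e' t"
    by (rule val_cong, rule Less, simp)+
  then show ?case by simp
next
  case (Neg p)
  have "sat M e p \<longleftrightarrow> sat M e' p" by (rule Neg.IH, rule Neg.prems, simp)
  then show ?case by simp
next
  case (And p q)
  have "sat M e p \<longleftrightarrow> sat M e' p" by (rule And.IH(1), rule And.prems, simp)
  moreover have "sat M e q \<longleftrightarrow> sat M e' q" by (rule And.IH(2), rule And.prems, simp)
  ultimately show ?case by simp
next
  case (Or p q)
  have "sat M e p \<longleftrightarrow> sat M e' p" by (rule Or.IH(1), rule Or.prems, simp)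
  moreover have "sat M e q \<longleftrightarrow> sat M e' q" by (rule Or.IH(2), rule Or.prems, simp)
  ultimately show ?case by simp
next
  case (Imp p q)
  have "sat M e p \<longleftrightarrow> sat M e' p" by (rule Imp.IH(1), rule Imp.prems, simp)
  moreover have "sat M e q \<longleftrightarrow> sat M e' q" by (rule Imp.IH(2), rule Imp.prems, simp)
  ultimately show ?case by simp
next
  case (All p)
  have "sat M (case_nat a e) p \<longleftrightarrow> sat M (case_nat a e') p" for a
    by (rule All.IH) (clarsimp split: nat.split, rule All.prems, simp)
  then show ?case by simp
next
  case (Ex p)
  have "sat M (case_nat a e) p \<longleftrightarrow> sat M (case_nat a e') p" for a
    by (rule Ex.IH) (clarsimp split: nat.split, rule Ex.prems, simp)
  then show ?case by simp
qed

text \<open>The assignment after binding the values \<open>as\<close>, outermost first.\<close>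

definition bind :: "'a list \<Rightarrow> (nat \<Rightarrow> 'a) \<Rightarrow> nat \<Rightarrow> 'a" where
  "bind as e = fold case_nat as e"

lemma sat_Alls:
  fixes M :: "'a struc"
  shows "sat M e (Alls n p) \<longleftrightarrow> (\<forall>as. length as = n \<longrightarrow> sat M (bind as e) p)"
  unfolding Alls_def bind_def
proof (induction n arbitrary: e)
  case (Suc n)
  have *: "(\<forall>as. length as = Suc n \<longrightarrow> P as) \<longleftrightarrow> (\<forall>a as. length as = n \<longrightarrow> P (a # as))"
    for P :: "'a list \<Rightarrow> bool" by (auto simp: length_Suc_conv)
  show ?case unfolding * by (simp add: Suc)
qed simp

lemma sat_Exs:
  fixes M :: "'a struc"
  shows "sat M e (Exs n p) \<longleftrightarrow> (\<exists>as. length as = n \<and> sat M (bind as e) p)"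
  unfolding Exs_def bind_def
proof (induction n arbitrary: e)
  case (Suc n)
  have *: "(\<exists>as. length as = Suc n \<and> P as) \<longleftrightarrow> (\<exists>a as. length as = n \<and> P (a # as))"
    for P :: "'a list \<Rightarrow> bool" by (force simp: length_Suc_conv)
  show ?case unfolding * by (simp add: Suc)
qed simp

lemma bind_shift: "bind as e (k + length as) = e k"
  unfolding bind_def by (induction as arbitrary: e k rule: rev_induct) auto

lemma bind_nth: "k < length as \<Longrightarrow> bind as e k = rev as ! k"
  unfolding bind_def
  by (induction as arbitrary: k rule: rev_induct) (auto split: nat.split simp: nth_Cons)

lemma length_block [simp]: "length (block b n) = n" by (simp add: block_def)

lemma block_nth: "i < n \<Longrightarrow> block b n ! i = Var (b + (n - Suc i))"
  by (simp add: block_def rev_nth)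

lemma val_block: "map (val M (bind as e)) (block 0 (length as)) = as"
  by (rule nth_equalityI) (auto simp: block_def rev_nth bind_nth)

lemma val_block_bind: "map (val M (bind as e)) (block (length as + b) n) = map (val M e) (block b n)"
proof -
  have "bind as e (length as + k) = e k" for k by (metis bind_shift add.commute)
  then have "val M (bind as e) (block (length as + b) n ! i) = val M e (block b n ! i)" if "i < n" for i
    using that \<open>\<And>k. bind as e (length as + k) = e k\<close>[of "b + (n - Suc i)"] by (simp only: block_nth val.simps add.assoc)
  then show ?thesis by (intro nth_equalityI) auto
qed

lemma val_block_Suc: "map (val M (case_nat a e)) (block (Suc b) n) = map (val M e) (block b n)"
  by (intro nth_equalityI) (auto simp: block_nth)

lemma sat_inst:
  assumes "fv \<psi> \<subseteq> {..<length xs + 1 + length zs}"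
  shows "sat M e (inst \<psi> xs y zs) \<longleftrightarrow>
    sat M ((!) (map (val M e) xs @ val M e y # map (val M e) zs)) \<psi>"
  unfolding inst_def sat_subst
proof (rule sat_cong)
  fix k assume "k \<in> fv \<psi>"
  then have "k < length (xs @ y # zs)" using assms by auto
  then have "val M e ((xs @ y # zs) ! k) = map (val M e) (xs @ y # zs) ! k" by (simp only: nth_map)
  then show "val M e ((xs @ y # zs) ! k) = (map (val M e) xs @ val M e y # map (val M e) zs) ! k" by simp
qed

lemma sat_vec_eq:
  "length ss = length ts \<Longrightarrow> sat M e (vec_eq ss ts) \<longleftrightarrow> map (val M e) ss = map (val M e) ts"
  unfolding vec_eq_def by (induction ss ts rule: list_induct2) auto

text \<open>The relations that the formulas above define in a structure.\<close>

definition le_in :: "'a struc \<Rightarrow> 'a \<Rightarrow> 'a \<Rightarrow> bool" where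
  "le_in M a b \<longleftrightarrow> less_of M a b \<or> a = b"

definition pair_in :: "'a struc \<Rightarrow> 'a \<Rightarrow> 'a \<Rightarrow> 'a \<Rightarrow> bool" where
  "pair_in M x y z \<longleftrightarrow> (\<exists>h.
     (let s = mul_of M (add_of M (add_of M x y) (one_of M)) (add_of M x y)
      in add_of M h h = s \<or> add_of M (add_of M h h) (one_of M) = s) \<and> z = add_of M h y)"

definition rem_in :: "'a struc \<Rightarrow> 'a \<Rightarrow> 'a \<Rightarrow> 'a \<Rightarrow> bool" where
  "rem_in M a b r \<longleftrightarrow> less_of M r b \<and> (\<exists>q. a = add_of M (mul_of M b q) r)"

definition beta_in :: "'a struc \<Rightarrow> 'a \<Rightarrow> 'a \<Rightarrow> 'a \<Rightarrow> bool" where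
  "beta_in M w i v \<longleftrightarrow> (\<exists>l r. (\<exists>y. pair_in M l y w) \<and> (\<exists>x. pair_in M x r w) \<and>
     rem_in M l (add_of M (mul_of M r (add_of M i (one_of M))) (one_of M)) v)"

fun tuple_in :: "'a struc \<Rightarrow> 'a list \<Rightarrow> 'a \<Rightarrow> bool" where
  "tuple_in M [] v \<longleftrightarrow> True"
| "tuple_in M [z] v \<longleftrightarrow> v = z"
| "tuple_in M (z # zs) v \<longleftrightarrow> (\<exists>u. tuple_in M zs u \<and> pair_in M z u v)"

lemma sat_pair_fm: "sat M e (pair_fm x y z) \<longleftrightarrow> pair_in M (val M e x) (val M e y) (val M e z)"
  by (simp add: pair_fm_def pair_in_def half_fm_def Let_def)

lemma sat_beta_fm: "sat M e (beta_fm w i v) \<longleftrightarrow> beta_in M (val M e w) (val M e i) (val M e v)"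
  by (simp add: beta_fm_def beta_in_def L_fm_def R_fm_def rem_fm_def rem_in_def sat_pair_fm Let_def)

lemma sat_tuple_fm: "sat M e (tuple_fm zs v) \<longleftrightarrow> tuple_in M (map (val M e) zs) (val M e v)"
  by (induction zs v arbitrary: e rule: tuple_fm.induct) (auto simp: sat_pair_fm o_def)

lemma sat_Le: "sat M e (Le s t) \<longleftrightarrow> le_in M (val M e s) (val M e t)"
  by (simp add: Le_def le_in_def)

lemma sat_decode_fm: "sat M e (decode_fm w i zs) \<longleftrightarrow>
    (\<exists>v. beta_in M (val M e w) (val M e i) v \<and> tuple_in M (map (val M e) zs) v)"
  by (simp add: decode_fm_def sat_beta_fm sat_tuple_fm o_def)

lemma holds_coding_sentence:
  fixes M :: "'a struc"
  assumes "fv \<psi> \<subseteq> {..<m + 1 + n}"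
  shows "M \<Turnstile> coding_sentence m n \<psi> \<longleftrightarrow>
    (\<forall>xs y. length xs = m \<longrightarrow>
      (\<forall>i. le_in M i y \<longrightarrow> (\<exists>!zs. length zs = n \<and> sat M ((!) (xs @ i # zs)) \<psi>)) \<longrightarrow>
      (\<exists>w. \<forall>i. le_in M i y \<longrightarrow> (\<forall>zs. length zs = n \<longrightarrow> sat M ((!) (xs @ i # zs)) \<psi> \<longrightarrow>
         (\<exists>v. beta_in M w i v \<and> tuple_in M zs v))))"
proof -
  have inst: "sat M e (inst \<psi> xs y zs) \<longleftrightarrow>
      sat M ((!) (map (val M e) xs @ val M e y # map (val M e) zs)) \<psi>"
    if "length xs = m" "length zs = n" for e xs y zs
    using sat_inst assms that by blast
  have bl: "map (val M (bind xs e)) (block 0 m) = xs"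
      "map (val M (case_nat a (bind xs e))) (block 1 m) = xs"
      "map (val M (case_nat b (case_nat a (bind xs e)))) (block 2 m) = xs"
      "map (val M (case_nat c (case_nat b (case_nat a (bind xs e))))) (block 3 m) = xs"
    if "length xs = m" for xs e a b c
    using that by (auto simp: val_block val_block_Suc numeral_2_eq_2 numeral_3_eq_3)
  have blb: "map (val M (bind zs e)) (block (n + b) k) = map (val M e) (block b k)"
    "bind zs e (n + b) = e b" if "length zs = n" for zs e b k
    using that val_block_bind[of M zs e b k] bind_shift[of zs e b] by (simp_all add: add.commute)
  have blk: "map (val M (bind zs e)) (block 0 n) = zs" if "length zs = n" for zs e
    using that val_block by blast
  note blbs = blb blb(1)[where b = 0, simplified] blb(2)[where b = 0, simplified]
    blb(2)[where b = 1, simplified] blb(1)[where b = 2, simplified]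
    blb(1)[where b = "n + 2", simplified] blk
  have two: "block (2 * n + 2) m = block (n + (n + 2)) m" "2 * n = n + n" by (simp_all only: mult_2 add.assoc)
  have ex1: "(\<exists>!zs. length zs = n \<and> P zs) \<longleftrightarrow>
     (\<exists>zs. length zs = n \<and> P zs \<and> (\<forall>zs'. length zs' = n \<longrightarrow> P zs' \<longrightarrow> zs' = zs))"
    for P :: "'a list \<Rightarrow> bool" by auto
  show ?thesis
    unfolding holds_def coding_sentence_def two ex1
    by (simp add: sat_Alls sat_Exs sat_Le inst bl blbs sat_vec_eq sat_decode_fm
        cong: conj_cong imp_cong)
qed

end

theory Submission
  imports Defs
begin

text \<open>
  Let \<open>F i v\<close> say that \<open>v\<close> codes a tuple \<open>z\<close> with \<open>\<psi>(x,i,z)\<close>. Induction gives \<open>b\<close> such that every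
  \<open>i \<le> y\<close> has a value \<open>v < b\<close>, and a common multiple \<open>r\<close> of \<open>1, \<dots>, y + 1\<close> and \<open>b\<close>. The moduli
  \<open>m\<^sub>i = r(i + 1) + 1\<close> are then larger than the values, and pairwise invertible modulo each other.
  The Chinese remainder theorem is proved by induction on \<open>k\<close>: there are \<open>l\<close> with the right remainders
  modulo \<open>m\<^sub>i\<close> for \<open>i < k\<close>, and a common multiple \<open>p\<close> of these \<open>m\<^sub>i\<close> that is invertible modulo \<open>m\<^sub>j\<close> for
  \<open>k \<le> j \<le> y\<close>; if \<open>p u \<equiv> 1\<close> modulo \<open>m\<^sub>k\<close>, the next pair is \<open>l + p u c\<close>, \<open>p m\<^sub>k\<close> with a suitable \<open>c\<close>.
  Only the existence of codes is needed, never that pairing is injective.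
\<close>

section \<open>Definability with parameters\<close>

text \<open>A variable of a formula is read either as a coordinate of the assignment or as a parameter.\<close>

definition inst_env :: "(nat \<Rightarrow> nat + 'a) \<Rightarrow> (nat \<Rightarrow> 'a) \<Rightarrow> nat \<Rightarrow> 'a" where
  "inst_env s e k = (case s k of Inl j \<Rightarrow> e j | Inr a \<Rightarrow> a)"

text \<open>Both the formula and the reading of its variables are existentially quantified, so
  closure rules on HOL predicates take the place of explicit formulas in the inductions
  below.\<close>

definition definable :: "'a struc \<Rightarrow> ((nat \<Rightarrow> 'a) \<Rightarrow> bool) \<Rightarrow> bool" where
  "definable M P \<longleftrightarrow> (\<exists>p s. \<forall>e. P e \<longleftrightarrow> sat M (inst_env s e) p)"

definition definable_term :: "'a struc \<Rightarrow> ((nat \<Rightarrow> 'a) \<Rightarrow> 'a) \<Rightarrow> bool" where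
  "definable_term M f \<longleftrightarrow> (\<exists>t s. \<forall>e. f e = val M (inst_env s e) t)"

text \<open>Even variables are read by \<open>s\<close> and odd ones by \<open>s'\<close>, so two
  formulas with different parameters can be joined without a clash.\<close>

definition merge :: "(nat \<Rightarrow> 'b) \<Rightarrow> (nat \<Rightarrow> 'b) \<Rightarrow> nat \<Rightarrow> 'b" where
  "merge s s' k = (if even k then s (k div 2) else s' (k div 2))"

lemma inst_env_merge:
  "(\<lambda>k. inst_env (merge s s') e (2 * k)) = inst_env s e"
  "(\<lambda>k. inst_env (merge s s') e (Suc (2 * k))) = inst_env s' e"
  by (auto simp: inst_env_def merge_def fun_eq_iff)

lemma definable_not: "definable M P \<Longrightarrow> definable M (\<lambda>e. \<not> P e)"
  unfolding definable_def by (metis sat.simps(3))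

lemma sat_merge:
  "sat M (inst_env (merge s s') e) (subst (\<lambda>k. Var (2 * k)) p) \<longleftrightarrow> sat M (inst_env s e) p"
  "sat M (inst_env (merge s s') e) (subst (\<lambda>k. Var (Suc (2 * k))) p) \<longleftrightarrow> sat M (inst_env s' e) p"
  by (simp_all add: sat_subst inst_env_merge)

lemma val_merge:
  "val M (inst_env (merge s s') e) (subst_tm (\<lambda>k. Var (2 * k)) t) = val M (inst_env s e) t"
  "val M (inst_env (merge s s') e) (subst_tm (\<lambda>k. Var (Suc (2 * k))) t) = val M (inst_env s' e) t"
  by (simp_all add: val_subst inst_env_merge)

lemma definable_and:
  assumes "definable M P" "definable M Q"
  shows "definable M (\<lambda>e. P e \<and> Q e)"
proof -
  obtain p s q s' where "\<And>e. P e \<longleftrightarrow> sat M (inst_env s e) p" "\<And>e. Q e \<longleftrightarrow> sat M (inst_env s' e) q"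
    using assms unfolding definable_def by blast
  then have "(P e \<and> Q e) \<longleftrightarrow> sat M (inst_env (merge s s') e)
      (And (subst (\<lambda>k. Var (2 * k)) p) (subst (\<lambda>k. Var (Suc (2 * k))) q))" for e
    by (simp add: sat_merge)
  then show ?thesis unfolding definable_def by blast
qed

lemma definable_imp:
  assumes "definable M P" "definable M Q"
  shows "definable M (\<lambda>e. P e \<longrightarrow> Q e)"
  using definable_not[OF definable_and[OF assms(1) definable_not[OF assms(2)]]] by simp

lemma definable_or:
  assumes "definable M P" "definable M Q"
  shows "definable M (\<lambda>e. P e \<or> Q e)"
  using definable_imp[OF definable_not[OF assms(1)] assms(2)] by (simp add: disj_imp)

lemma definable_eq:
  assumes "definable_term M f" "definable_term M g"
  shows "definable M (\<lambda>e. f e = g e)"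
proof -
  obtain t s u s' where "\<And>e. f e = val M (inst_env s e) t" "\<And>e. g e = val M (inst_env s' e) u"
    using assms unfolding definable_term_def by blast
  then have "(f e = g e) \<longleftrightarrow> sat M (inst_env (merge s s') e)
      (Eq (subst_tm (\<lambda>k. Var (2 * k)) t) (subst_tm (\<lambda>k. Var (Suc (2 * k))) u))" for e
    by (simp add: val_merge)
  then show ?thesis unfolding definable_def by blast
qed

lemma definable_less:
  assumes "definable_term M f" "definable_term M g"
  shows "definable M (\<lambda>e. less_of M (f e) (g e))"
proof -
  obtain t s u s' where "\<And>e. f e = val M (inst_env s e) t" "\<And>e. g e = val M (inst_env s' e) u"
    using assms unfolding definable_term_def by blast
  then have "less_of M (f e) (g e) \<longleftrightarrow> sat M (inst_env (merge s s') e)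
      (Less (subst_tm (\<lambda>k. Var (2 * k)) t) (subst_tm (\<lambda>k. Var (Suc (2 * k))) u))" for e
    by (simp add: val_merge)
  then show ?thesis unfolding definable_def by blast
qed

lemma definable_term_var: "definable_term M (\<lambda>e. e k)"
  unfolding definable_term_def
  by (rule exI[of _ "Var 0"], rule exI[of _ "\<lambda>_. Inl k"]) (simp add: inst_env_def)

lemma definable_term_const: "definable_term M (\<lambda>e. a)"
  unfolding definable_term_def
  by (rule exI[of _ "Var 0"], rule exI[of _ "\<lambda>_. Inr a"]) (simp add: inst_env_def)

lemma definable_term_add:
  assumes "definable_term M f" "definable_term M g"
  shows "definable_term M (\<lambda>e. add_of M (f e) (g e))"
proof -
  obtain t s u s' where "\<And>e. f e = val M (inst_env s e) t" "\<And>e. g e = val M (inst_env s' e) u"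
    using assms unfolding definable_term_def by blast
  then have "add_of M (f e) (g e) = val M (inst_env (merge s s') e)
      (Add (subst_tm (\<lambda>k. Var (2 * k)) t) (subst_tm (\<lambda>k. Var (Suc (2 * k))) u))" for e
    by (simp add: val_merge)
  then show ?thesis unfolding definable_term_def by blast
qed

lemma definable_term_mul:
  assumes "definable_term M f" "definable_term M g"
  shows "definable_term M (\<lambda>e. mul_of M (f e) (g e))"
proof -
  obtain t s u s' where "\<And>e. f e = val M (inst_env s e) t" "\<And>e. g e = val M (inst_env s' e) u"
    using assms unfolding definable_term_def by blast
  then have "mul_of M (f e) (g e) = val M (inst_env (merge s s') e)
      (Mul (subst_tm (\<lambda>k. Var (2 * k)) t) (subst_tm (\<lambda>k. Var (Suc (2 * k))) u))" for e
    by (simp add: val_merge)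
  then show ?thesis unfolding definable_term_def by blast
qed

text \<open>Every variable that reads coordinate 0 is redirected to the new bound variable; the
  other coordinates move down by one.\<close>

lemma definable_ex:
  assumes "definable M (\<lambda>e. P (\<lambda>k. e (Suc k)) (e 0))"
  shows "definable M (\<lambda>e. \<exists>a. P e a)"
proof -
  obtain p s where p: "\<And>e. P (\<lambda>k. e (Suc k)) (e 0) \<longleftrightarrow> sat M (inst_env s e) p"
    using assms unfolding definable_def by blast
  define \<sigma> where "\<sigma> k = (if s k = Inl 0 then Var 0 else Var (Suc k))" for k
  \<comment> \<open>Coordinate 0 stays at 0 under truncated subtraction, which is harmless:
    \<open>\<sigma>\<close> sends exactly these variables to \<open>Var 0\<close>.\<close>
  define s' where "s' k = (case s k of Inl j \<Rightarrow> Inl (j - 1) | Inr a \<Rightarrow> Inr a)" for k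
  have "(\<lambda>k. val M (case_nat a (inst_env s' e)) (\<sigma> k)) = inst_env s (case_nat a e)" for a e
    by (auto simp: \<sigma>_def s'_def inst_env_def fun_eq_iff split: sum.split nat.split)
  then have "P e a \<longleftrightarrow> sat M (case_nat a (inst_env s' e)) (subst \<sigma> p)" for e a
    using p[of "case_nat a e"] by (simp add: sat_subst)
  then have "(\<exists>a. P e a) \<longleftrightarrow> sat M (inst_env s' e) (Ex (subst \<sigma> p))" for e by simp
  then show ?thesis unfolding definable_def by blast
qed

lemma definable_all:
  assumes "definable M (\<lambda>e. P (\<lambda>k. e (Suc k)) (e 0))"
  shows "definable M (\<lambda>e. \<forall>a. P e a)"
  using definable_not[OF definable_ex[of M "\<lambda>e a. \<not> P e a"]] definable_not[OF assms] by simp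

lemmas definable_intros =
  definable_not definable_and definable_or definable_imp definable_ex definable_all
  definable_eq definable_less
  definable_term_var definable_term_const definable_term_add definable_term_mul

lemma definable_subst2:
  assumes "definable M (\<lambda>e. P (e 0) (e 1))" "definable_term M f" "definable_term M g"
  shows "definable M (\<lambda>e. P (f e) (g e))"
proof -
  obtain p s where p: "\<And>e. P (e 0) (e 1) \<longleftrightarrow> sat M (inst_env s e) p"
    using assms(1) unfolding definable_def by blast
  obtain t r where t: "\<And>e. f e = val M (inst_env r e) t"
    using assms(2) unfolding definable_term_def by blast
  obtain t' r' where t': "\<And>e. g e = val M (inst_env r' e) t'"
    using assms(3) unfolding definable_term_def by blast
  define u where "u = merge s (merge r r')"
  \<comment> \<open>Every coordinate after 0 receives the term for \<open>g\<close>: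
    \<open>P\<close> sees only two coordinates, so the assignment can be taken constant from 1
    on.\<close>
  define \<sigma> where "\<sigma> k = (case s k of
      Inl 0 \<Rightarrow> subst_tm (\<lambda>k. Var (Suc (2 * k))) (subst_tm (\<lambda>k. Var (2 * k)) t)
    | Inl (Suc _) \<Rightarrow> subst_tm (\<lambda>k. Var (Suc (2 * k))) (subst_tm (\<lambda>k. Var (Suc (2 * k))) t')
    | Inr _ \<Rightarrow> Var (2 * k))" for k
  have "val M (inst_env u e) (\<sigma> k) = inst_env s (case_nat (f e) (\<lambda>_. g e)) k" for e k
  proof (cases "s k")
    case (Inl j)
    then show ?thesis
      by (cases j) (simp_all add: \<sigma>_def u_def val_merge t t' inst_env_def[of s])
  next
    case (Inr a)
    then show ?thesis by (simp add: \<sigma>_def u_def inst_env_def merge_def)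
  qed
  then have "P (f e) (g e) \<longleftrightarrow> sat M (inst_env u e) (subst \<sigma> p)" for e
    using p[of "case_nat (f e) (\<lambda>_. g e)"] by (simp add: sat_subst)
  then show ?thesis unfolding definable_def by blast
qed

section \<open>Models of Peano arithmetic\<close>

locale PA_model =
  fixes M :: "'a struc"
  assumes PA: "M \<Turnstile>* PA"
begin

abbreviation pl (infixl "\<oplus>" 65) where "x \<oplus> y \<equiv> add_of M x y"
abbreviation ti (infixl "\<otimes>" 70) where "x \<otimes> y \<equiv> mul_of M x y"
abbreviation ze ("\<zero>") where "\<zero> \<equiv> zero_of M"
abbreviation un ("\<one>") where "\<one> \<equiv> one_of M"
abbreviation ls (infix "\<prec>" 50) where "x \<prec> y \<equiv> less_of M x y"

lemma PA_axioms:
  "x \<oplus> y \<oplus> z = x \<oplus> (y \<oplus> z)"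
  "x \<oplus> y = y \<oplus> x"
  "x \<otimes> y \<otimes> z = x \<otimes> (y \<otimes> z)"
  "x \<otimes> y = y \<otimes> x"
  "x \<otimes> (y \<oplus> z) = x \<otimes> y \<oplus> x \<otimes> z"
  "x \<oplus> \<zero> = x"
  "x \<otimes> \<zero> = \<zero>"
  "x \<otimes> \<one> = x"
  "x \<prec> y \<Longrightarrow> y \<prec> z \<Longrightarrow> x \<prec> z"
  "\<not> x \<prec> x"
  "x \<prec> y \<or> x = y \<or> y \<prec> x"
  "x \<prec> y \<Longrightarrow> x \<oplus> z \<prec> y \<oplus> z"
  "\<zero> \<prec> z \<Longrightarrow> x \<prec> y \<Longrightarrow> x \<otimes> z \<prec> y \<otimes> z"
  "x \<prec> y \<Longrightarrow> \<exists>z. x \<oplus> z = y"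
  "\<zero> \<prec> \<one>"
  "\<zero> \<prec> x \<Longrightarrow> \<one> \<prec> x \<or> \<one> = x"
  "\<zero> \<prec> x \<or> \<zero> = x"
proof -
  define e where "e = case_nat x (case_nat y (\<lambda>_. z))"
  have e: "e 0 = x" "e 1 = y" "e 2 = z" by (auto simp: e_def numeral_2_eq_2)
  have s: "\<forall>p\<in>PA_minus. sat M e p"
    using PA unfolding models_def PA_def holds_def by blast
  show
    "x \<oplus> y \<oplus> z = x \<oplus> (y \<oplus> z)"
    "x \<oplus> y = y \<oplus> x"
    "x \<otimes> y \<otimes> z = x \<otimes> (y \<otimes> z)"
    "x \<otimes> y = y \<otimes> x"
    "x \<otimes> (y \<oplus> z) = x \<otimes> y \<oplus> x \<otimes> z"
    "x \<oplus> \<zero> = x"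
    "x \<otimes> \<zero> = \<zero>"
    "x \<otimes> \<one> = x"
    "x \<prec> y \<Longrightarrow> y \<prec> z \<Longrightarrow> x \<prec> z"
    "\<not> x \<prec> x"
    "x \<prec> y \<or> x = y \<or> y \<prec> x"
    "x \<prec> y \<Longrightarrow> x \<oplus> z \<prec> y \<oplus> z"
    "\<zero> \<prec> z \<Longrightarrow> x \<prec> y \<Longrightarrow> x \<otimes> z \<prec> y \<otimes> z"
    "x \<prec> y \<Longrightarrow> \<exists>z. x \<oplus> z = y"
    "\<zero> \<prec> \<one>"
    "\<zero> \<prec> x \<Longrightarrow> \<one> \<prec> x \<or> \<one> = x"
    "\<zero> \<prec> x \<or> \<zero> = x"
    using s unfolding PA_minus_def Let_def Le_def ball_simps sat.simps val.simps val_lift e nat.case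
    by blast+
qed

text \<open>Brings the library's semiring algebra to \<open>M\<close>. There is no subtraction, so
  congruences below are stated as equations between sums.\<close>

sublocale comm_semiring_1 where one = "\<one>" and times = "(\<otimes>)" and plus = "(\<oplus>)" and zero = "\<zero>"
proof
  show "\<zero> \<noteq> \<one>" using PA_axioms(10,15) by metis
qed (use PA_axioms(1-8) in \<open>metis+\<close>)

declare one_add_one [simp del]

text \<open>The parameters hidden in the HOL predicate become the free variables of an instance of
  the induction schema.\<close>

lemma PA_induct:
  assumes "definable M (\<lambda>e. P (e 0))" "P \<zero>" "\<And>a. P a \<Longrightarrow> P (a \<oplus> \<one>)"
  shows "P a"
proof -
  obtain p s where p: "\<And>e. P (e 0) \<longleftrightarrow> sat M (inst_env s e) p"
    using assms(1) unfolding definable_def by blast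
  \<comment> \<open>\<open>P\<close> depends on coordinate 0 only, so all coordinate variables are
    identified with the induction variable \<open>Var 0\<close>.\<close>
  define \<sigma> where "\<sigma> k = (case s k of Inl _ \<Rightarrow> Var 0 | Inr _ \<Rightarrow> Var (Suc k))" for k
  define c where "c k = (case s k of Inl _ \<Rightarrow> \<zero> | Inr a \<Rightarrow> a)" for k
  define q where "q = subst \<sigma> p"
  have "val M (case_nat a c) (\<sigma> k) = inst_env s (\<lambda>_. a) k" for a k
    by (auto simp: \<sigma>_def c_def inst_env_def split: sum.split)
  then have q: "sat M (case_nat a c) q \<longleftrightarrow> P a" for a
    using p[of "\<lambda>_. a"] by (simp add: q_def sat_subst)
  have ax: "sat M c (induction_ax q)"
    using PA unfolding models_def PA_def holds_def by blast
  have env: "(\<lambda>k. val M c (case_nat Zero Var k)) = case_nat \<zero> c"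
    "(\<lambda>k. val M (case_nat a c) ((Var(0 := Add (Var 0) One)) k)) = case_nat (a \<oplus> \<one>) c" for a
    by (auto simp: fun_eq_iff split: nat.split)
  show ?thesis
    using ax assms(2,3) unfolding induction_ax_def by (simp add: sat_subst env q del: fun_upd_apply)
qed

section \<open>Discreteness and order estimates\<close>

text \<open>A nonzero difference is at least \<open>\<one>\<close>, so nothing lies strictly between
  \<open>b\<close> and \<open>b \<oplus> \<one>\<close>.\<close>

lemma less_Suc_iff: "a \<prec> b \<oplus> \<one> \<longleftrightarrow> a \<prec> b \<or> a = b"
proof
  assume a: "a \<prec> b \<oplus> \<one>"
  show "a \<prec> b \<or> a = b"
  proof (rule ccontr)
    assume "\<not> (a \<prec> b \<or> a = b)"
    then have "b \<prec> a" using PA_axioms(11) by blast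
    then obtain z where z: "b \<oplus> z = a" using PA_axioms(14) by blast
    have "z \<noteq> \<zero>" using z \<open>b \<prec> a\<close> PA_axioms(6,10) by metis
    then have "\<one> \<prec> z \<or> \<one> = z" using PA_axioms(16,17) by metis
    then have "b \<oplus> \<one> \<prec> a \<or> b \<oplus> \<one> = a" using z PA_axioms(12)[of \<one> z b] by (metis PA_axioms(2))
    then show False using a PA_axioms(9,10) by metis
  qed
next
  have "b \<prec> b \<oplus> \<one>" using PA_axioms(12)[OF PA_axioms(15), of b] by (simp add: PA_axioms(2)[of \<one>])
  then show "a \<prec> b \<or> a = b \<Longrightarrow> a \<prec> b \<oplus> \<one>" using PA_axioms(9) by metis
qed

lemma not_less_zero: "\<not> a \<prec> \<zero>"
  using PA_axioms(9,10,17) by metis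

lemma less_add_left: "\<zero> \<prec> b \<Longrightarrow> a \<prec> a \<oplus> b"
  using PA_axioms(12)[of \<zero> b a] by (simp add: PA_axioms(2)[of b])

lemma zero_less_Suc: "\<zero> \<prec> a \<oplus> \<one>"
  using PA_axioms(17) less_Suc_iff by metis

lemma pos_imp_Suc: "\<zero> \<prec> a \<Longrightarrow> \<exists>b. a = b \<oplus> \<one>"
  using PA_axioms(14)[of \<one> a] PA_axioms(16)[of a] PA_axioms(2) add_0_left by metis

lemma mult_pos: "\<zero> \<prec> a \<Longrightarrow> \<zero> \<prec> b \<Longrightarrow> \<zero> \<prec> a \<otimes> b"
  using PA_axioms(13)[of b \<zero> a] by simp

text \<open>Writing \<open>r\<close> as a successor exhibits \<open>b\<close> as a summand of
  \<open>b \<otimes> r\<close>.\<close>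

lemma less_mult_pos: "\<zero> \<prec> r \<Longrightarrow> a \<prec> b \<Longrightarrow> a \<prec> b \<otimes> r"
proof -
  assume "\<zero> \<prec> r" "a \<prec> b"
  then obtain r' where r: "r = r' \<oplus> \<one>" using pos_imp_Suc by blast
  have "b \<otimes> r = b \<oplus> b \<otimes> r'" by (simp add: r distrib_left add.commute)
  moreover have "b \<otimes> r' = \<zero> \<or> \<zero> \<prec> b \<otimes> r'" using PA_axioms(17) by metis
  ultimately have "b \<otimes> r = b \<or> b \<prec> b \<otimes> r" using less_add_left by auto
  then show ?thesis using \<open>a \<prec> b\<close> PA_axioms(9) by metis
qed

section \<open>Collection and common multiples\<close>

text \<open>Collection by induction on \<open>k\<close>. The bound is kept positive because it later
  becomes a factor of the number that generates the moduli.\<close>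

lemma collection:
  assumes F: "definable M (\<lambda>e. F (e 0) (e 1))" and tot: "\<And>i. \<exists>v. F i v"
  shows "\<exists>b. \<zero> \<prec> b \<and> (\<forall>i. i \<prec> k \<longrightarrow> (\<exists>v. v \<prec> b \<and> F i v))"
proof (rule PA_induct[of "\<lambda>k. \<exists>b. \<zero> \<prec> b \<and> (\<forall>i. i \<prec> k \<longrightarrow> (\<exists>v. v \<prec> b \<and> F i v))"])
  show "definable M (\<lambda>e. \<exists>b. \<zero> \<prec> b \<and> (\<forall>i. i \<prec> e 0 \<longrightarrow> (\<exists>v. v \<prec> b \<and> F i v)))"
    by (intro definable_intros definable_subst2[OF F])
  show "\<exists>b. \<zero> \<prec> b \<and> (\<forall>i. i \<prec> \<zero> \<longrightarrow> (\<exists>v. v \<prec> b \<and> F i v))"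
    using PA_axioms(15) not_less_zero by blast
next
  fix k assume "\<exists>b. \<zero> \<prec> b \<and> (\<forall>i. i \<prec> k \<longrightarrow> (\<exists>v. v \<prec> b \<and> F i v))"
  then obtain b where b: "\<zero> \<prec> b" "\<And>i. i \<prec> k \<Longrightarrow> \<exists>v. v \<prec> b \<and> F i v" by blast
  obtain v where v: "F k v" using tot by blast
  \<comment> \<open>This sum lies strictly above both the old bound and the new value.\<close>
  define c where "c = b \<oplus> (v \<oplus> \<one>)"
  have bc: "b \<prec> c" using less_add_left zero_less_Suc by (simp add: c_def)
  have "c = v \<oplus> (b \<oplus> \<one>)" by (simp add: c_def ac_simps)
  then have vc: "v \<prec> c" using less_add_left zero_less_Suc by metis
  have "\<exists>u. u \<prec> c \<and> F i u" if "i \<prec> k \<oplus> \<one>" for i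
    using that b(2) bc v vc PA_axioms(9) unfolding less_Suc_iff by metis
  moreover have "\<zero> \<prec> c" using b(1) bc PA_axioms(9) by metis
  ultimately show "\<exists>b. \<zero> \<prec> b \<and> (\<forall>i. i \<prec> k \<oplus> \<one> \<longrightarrow> (\<exists>v. v \<prec> b \<and> F i v))" by blast
qed

text \<open>A substitute for the factorial: the step multiplies by \<open>k \<oplus> \<one>\<close>,
  and no recursively defined function has to be expressed in the language.\<close>

lemma common_multiple: "\<exists>r. \<zero> \<prec> r \<and> (\<forall>i. i \<prec> k \<longrightarrow> (\<exists>q. r = (i \<oplus> \<one>) \<otimes> q))"
proof (rule PA_induct[of "\<lambda>k. \<exists>r. \<zero> \<prec> r \<and> (\<forall>i. i \<prec> k \<longrightarrow> (\<exists>q. r = (i \<oplus> \<one>) \<otimes> q))"])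
  show "definable M (\<lambda>e. \<exists>r. \<zero> \<prec> r \<and> (\<forall>i. i \<prec> e 0 \<longrightarrow> (\<exists>q. r = (i \<oplus> \<one>) \<otimes> q)))"
    by (intro definable_intros)
  show "\<exists>r. \<zero> \<prec> r \<and> (\<forall>i. i \<prec> \<zero> \<longrightarrow> (\<exists>q. r = (i \<oplus> \<one>) \<otimes> q))"
    using PA_axioms(15) not_less_zero by blast
next
  fix k assume "\<exists>r. \<zero> \<prec> r \<and> (\<forall>i. i \<prec> k \<longrightarrow> (\<exists>q. r = (i \<oplus> \<one>) \<otimes> q))"
  then obtain r where r: "\<zero> \<prec> r" "\<And>i. i \<prec> k \<Longrightarrow> \<exists>q. r = (i \<oplus> \<one>) \<otimes> q" by blast
  have "\<exists>q. (k \<oplus> \<one>) \<otimes> r = (i \<oplus> \<one>) \<otimes> q" if "i \<prec> k \<oplus> \<one>" for i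
    using that r(2) unfolding less_Suc_iff by (metis mult.left_commute)
  then show "\<exists>r. \<zero> \<prec> r \<and> (\<forall>i. i \<prec> k \<oplus> \<one> \<longrightarrow> (\<exists>q. r = (i \<oplus> \<one>) \<otimes> q))"
    using mult_pos[OF zero_less_Suc r(1)] by blast
qed

section \<open>Chinese remainder theorem\<close>

text \<open>Stands in for coprimality; its witness \<open>u\<close> is at once the inverse by which
  the Chinese remainder step multiplies.\<close>

definition invertible_mod :: "'a \<Rightarrow> 'a \<Rightarrow> bool" where
  "invertible_mod a b \<longleftrightarrow> (\<exists>u t. a \<otimes> u = b \<otimes> t \<oplus> \<one>)"

text \<open>The product of the inverses is an inverse of the product.\<close>

lemma invertible_mod_mult:
  assumes "invertible_mod a c" "invertible_mod b c"
  shows "invertible_mod (a \<otimes> b) c"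
proof -
  obtain u t u' t' where "a \<otimes> u = c \<otimes> t \<oplus> \<one>" "b \<otimes> u' = c \<otimes> t' \<oplus> \<one>"
    using assms unfolding invertible_mod_def by blast
  then have "(a \<otimes> u) \<otimes> (b \<otimes> u') = (c \<otimes> t \<oplus> \<one>) \<otimes> (c \<otimes> t' \<oplus> \<one>)" by simp
  also have "\<dots> = c \<otimes> (t \<otimes> (c \<otimes> t' \<oplus> \<one>) \<oplus> t') \<oplus> \<one>" by (simp add: algebra_simps)
  finally show ?thesis unfolding invertible_mod_def by (metis mult.assoc mult.left_commute)
qed

text \<open>Write \<open>m\<^sub>k\<close>, \<open>m\<^sub>j\<close> for the two moduli, where \<open>j = k + d + 1\<close>. Multiplying
  \<open>m\<^sub>k (j + 1) = m\<^sub>j (k + 1) + (j - k)\<close> by \<open>q (j + 1)\<close> gives \<open>r (j + 1) = m\<^sub>j - 1 \<equiv> -1\<close> on the right,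
  and a further factor \<open>r (j + 1)\<close> turns \<open>-1\<close> into \<open>1\<close>.\<close>

lemma invertible_mod_beta_moduli:
  assumes r: "\<zero> \<prec> r" and d: "r = (d \<oplus> \<one>) \<otimes> q"
  shows "invertible_mod (r \<otimes> (k \<oplus> \<one>) \<oplus> \<one>) (r \<otimes> (k \<oplus> (d \<oplus> \<one>) \<oplus> \<one>) \<oplus> \<one>)"
proof -
  define J where "J = k \<oplus> (d \<oplus> \<one>) \<oplus> \<one>"
  define m where "m = r \<otimes> J \<oplus> \<one>"
  obtain s where s: "r \<otimes> J = s \<oplus> \<one>"
    using pos_imp_Suc mult_pos[OF r zero_less_Suc] J_def by blast
  have "(r \<otimes> (k \<oplus> \<one>) \<oplus> \<one>) \<otimes> J = m \<otimes> (k \<oplus> \<one>) \<oplus> (d \<oplus> \<one>)"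
    by (simp add: m_def J_def algebra_simps)
  then have "(r \<otimes> (k \<oplus> \<one>) \<oplus> \<one>) \<otimes> J \<otimes> (q \<otimes> J) = (m \<otimes> (k \<oplus> \<one>) \<oplus> (d \<oplus> \<one>)) \<otimes> (q \<otimes> J)" by simp
  also have "\<dots> = m \<otimes> ((k \<oplus> \<one>) \<otimes> (q \<otimes> J)) \<oplus> r \<otimes> J" unfolding d by (simp add: algebra_simps)
  finally have "(r \<otimes> (k \<oplus> \<one>) \<oplus> \<one>) \<otimes> J \<otimes> (q \<otimes> J) \<otimes> (s \<oplus> \<one>)
      = (m \<otimes> ((k \<oplus> \<one>) \<otimes> (q \<otimes> J)) \<oplus> (s \<oplus> \<one>)) \<otimes> (s \<oplus> \<one>)" by (simp add: s)
  \<comment> \<open>Here \<open>m\<close> equals \<open>s + 2\<close>, and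
    \<open>(s + 1)^2 = (s + 2) s + 1\<close>.\<close>
  also have "\<dots> = m \<otimes> ((k \<oplus> \<one>) \<otimes> (q \<otimes> J) \<otimes> (s \<oplus> \<one>) \<oplus> s) \<oplus> \<one>"
    unfolding m_def s by (simp add: algebra_simps)
  finally show ?thesis
    unfolding invertible_mod_def m_def J_def by (metis mult.assoc)
qed

lemma simultaneous_congruences:
  assumes F: "definable M (\<lambda>e. F (e 0) (e 1))"
    and bd: "\<And>i. i \<prec> y \<Longrightarrow> \<exists>v. v \<prec> r \<and> F i v"
    and dv: "\<And>i. i \<prec> y \<Longrightarrow> \<exists>q. r = (i \<oplus> \<one>) \<otimes> q"
    and r: "\<zero> \<prec> r"
  shows "\<exists>l. \<forall>i. i \<prec> y \<longrightarrow> (\<exists>v. F i v \<and> rem_in M l (r \<otimes> (i \<oplus> \<one>) \<oplus> \<one>) v)"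
proof -
  let ?m = "\<lambda>i. r \<otimes> (i \<oplus> \<one>) \<oplus> \<one>"
  \<comment> \<open>The multiple \<open>p\<close> of the moduli already treated lets
    \<open>l\<close> change without disturbing their remainders; its inverses modulo the others
    allow the next step.\<close>
  define Q where "Q k l p \<longleftrightarrow>
     (\<forall>i. i \<prec> k \<longrightarrow> (\<exists>q. p = ?m i \<otimes> q) \<and> (\<exists>v. F i v \<and> v \<prec> ?m i \<and> (\<exists>q. l = ?m i \<otimes> q \<oplus> v))) \<and>
     (\<forall>j. (k \<prec> j \<or> k = j) \<and> j \<prec> y \<longrightarrow> (\<exists>u t. p \<otimes> u = ?m j \<otimes> t \<oplus> \<one>))" for k l p
  \<comment> \<open>Values and divisibility are given below \<open>y\<close> only; the guard lets
    the induction run over all \<open>k\<close>.\<close>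
  define P where "P k \<longleftrightarrow> (k \<prec> y \<or> k = y \<longrightarrow> (\<exists>l p. Q k l p))" for k
  have "P k" for k
  proof (rule PA_induct[of P])
    show "definable M (\<lambda>e. P (e 0))"
      unfolding P_def Q_def by (intro definable_intros definable_subst2[OF F])
    \<comment> \<open>With no modulus treated, \<open>l\<close> is \<open>\<zero>\<close> and
      \<open>p\<close> is the empty product, its own inverse.\<close>
    have "\<one> \<otimes> \<one> = ?m j \<otimes> \<zero> \<oplus> \<one>" for j by simp
    then have "Q \<zero> \<zero> \<one>" unfolding Q_def using not_less_zero by blast
    then show "P \<zero>" unfolding P_def by blast
  next
    fix k assume k: "P k"
    show "P (k \<oplus> \<one>)"
    proof (cases "k \<prec> y")
      case False
      then have "\<not> (k \<oplus> \<one> \<prec> y \<or> k \<oplus> \<one> = y)"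
        using less_Suc_iff PA_axioms(9) by metis
      then show ?thesis unfolding P_def by blast
    next
      case True
      with k obtain l p where Q: "Q k l p" unfolding P_def by blast
      have
        lp: "\<And>i. i \<prec> k \<Longrightarrow> \<exists>q. p = ?m i \<otimes> q"
            "\<And>i. i \<prec> k \<Longrightarrow> \<exists>v. F i v \<and> v \<prec> ?m i \<and> (\<exists>q. l = ?m i \<otimes> q \<oplus> v)"
        and inv: "\<And>j. k \<prec> j \<or> k = j \<Longrightarrow> j \<prec> y \<Longrightarrow> invertible_mod p (?m j)"
        using Q unfolding Q_def invertible_mod_def by simp_all
      obtain v where v: "v \<prec> r" "F k v" using bd True by blast
      have vm: "v \<prec> ?m k"
        using less_mult_pos[OF zero_less_Suc v(1)] less_Suc_iff by blast
      obtain u t where u: "p \<otimes> u = ?m k \<otimes> t \<oplus> \<one>"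
        using inv True unfolding invertible_mod_def by blast
      \<comment> \<open>\<open>r (k + 1) \<equiv> -1\<close> modulo \<open>m\<^sub>k\<close>, so \<open>c \<equiv> v - l\<close>\<close>
      define c where "c = v \<oplus> l \<otimes> (r \<otimes> (k \<oplus> \<one>))"
      define l' where "l' = l \<oplus> p \<otimes> u \<otimes> c"
      define p' where "p' = p \<otimes> ?m k"
      have "l' = ?m k \<otimes> (t \<otimes> c) \<oplus> (l \<oplus> c)"
        unfolding l'_def u by (simp add: algebra_simps)
      also have "l \<oplus> c = ?m k \<otimes> l \<oplus> v" by (simp add: c_def algebra_simps)
      finally have lk: "l' = ?m k \<otimes> (t \<otimes> c \<oplus> l) \<oplus> v" by (simp add: distrib_left add.assoc)
      \<comment> \<open>Each earlier modulus divides \<open>p\<close>, so the added term changes the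
        quotient and keeps the remainder.\<close>
      have old: "\<exists>v. F i v \<and> v \<prec> ?m i \<and> (\<exists>q. l' = ?m i \<otimes> q \<oplus> v)" if i: "i \<prec> k" for i
      proof -
        obtain q where q: "p = ?m i \<otimes> q" using lp(1) i by blast
        obtain v q' where v: "F i v" "v \<prec> ?m i" "l = ?m i \<otimes> q' \<oplus> v" using lp(2) i by blast
        have "l' = ?m i \<otimes> (q' \<oplus> q \<otimes> u \<otimes> c) \<oplus> v"
          unfolding l'_def q v(3) by (simp only: distrib_left ac_simps)
        with v show ?thesis by blast
      qed
      have "(\<exists>q. p' = ?m i \<otimes> q) \<and> (\<exists>v. F i v \<and> v \<prec> ?m i \<and> (\<exists>q. l' = ?m i \<otimes> q \<oplus> v))"
        if "i \<prec> k \<oplus> \<one>" for i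
      proof (cases "i = k")
        case True
        then show ?thesis using v vm lk p'_def mult.commute by metis
      next
        case False
        then have "i \<prec> k" using that less_Suc_iff by blast
        then show ?thesis using lp(1) old p'_def mult.assoc by metis
      qed
      moreover have "invertible_mod p' (?m j)" if j: "k \<oplus> \<one> \<prec> j \<or> k \<oplus> \<one> = j" "j \<prec> y" for j
      proof -
        have kj: "k \<prec> j" using j(1) less_Suc_iff PA_axioms(9) by metis
        then obtain d' where d': "k \<oplus> d' = j" using PA_axioms(14) by blast
        have "d' \<noteq> \<zero>" using d' kj PA_axioms(6,10) by metis
        then obtain d where d: "d' = d \<oplus> \<one>" using pos_imp_Suc PA_axioms(17) by metis
        \<comment> \<open>The difference of \<open>j\<close> and \<open>k\<close> is
          \<open>d \<oplus> \<one>\<close> with \<open>d\<close> below \<open>y\<close>, so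
          \<open>dv\<close> at \<open>d\<close> makes it a divisor of \<open>r\<close>, which the
          lemma on two moduli requires.\<close>
        have "j = d \<oplus> (k \<oplus> \<one>)" using d d' by (simp add: ac_simps)
        then have "d \<prec> j" using less_add_left zero_less_Suc by metis
        then have "d \<prec> y" using j(2) PA_axioms(9) by metis
        then obtain q where "r = (d \<oplus> \<one>) \<otimes> q" using dv by blast
        from invertible_mod_beta_moduli[OF r this, of k] have "invertible_mod (?m k) (?m j)"
          using d d' by simp
        then show ?thesis unfolding p'_def using invertible_mod_mult inv kj j(2) by blast
      qed
      ultimately have "Q (k \<oplus> \<one>) l' p'" unfolding Q_def invertible_mod_def by simp
      then show ?thesis unfolding P_def by blast
    qed
  qed
  then obtain l p where "Q y l p" unfolding P_def by blast
  then show ?thesis unfolding Q_def rem_in_def by blast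
qed

section \<open>Existence of codes\<close>

text \<open>The point is the halving: by induction every element is \<open>h \<oplus> h\<close> or
  \<open>h \<oplus> h \<oplus> \<one>\<close>.\<close>

lemma pair_in_total: "\<exists>z. pair_in M x y z"
proof -
  have ind: "\<exists>h. h \<oplus> h = s \<or> h \<oplus> h \<oplus> \<one> = s" for s
  proof (rule PA_induct[of "\<lambda>s. \<exists>h. h \<oplus> h = s \<or> h \<oplus> h \<oplus> \<one> = s"])
    show "definable M (\<lambda>e. \<exists>h. h \<oplus> h = e 0 \<or> h \<oplus> h \<oplus> \<one> = e 0)"
      by (intro definable_intros)
    show "\<exists>h. h \<oplus> h = \<zero> \<or> h \<oplus> h \<oplus> \<one> = \<zero>" using PA_axioms(6) by metis
  next
    fix s assume "\<exists>h. h \<oplus> h = s \<or> h \<oplus> h \<oplus> \<one> = s"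
    then obtain h where "h \<oplus> h = s \<or> h \<oplus> h \<oplus> \<one> = s" by blast
    then show "\<exists>h. h \<oplus> h = s \<oplus> \<one> \<or> h \<oplus> h \<oplus> \<one> = s \<oplus> \<one>"
    proof
      assume "h \<oplus> h \<oplus> \<one> = s"
      then have "(h \<oplus> \<one>) \<oplus> (h \<oplus> \<one>) = s \<oplus> \<one>" by (auto simp: ac_simps)
      then show ?thesis by blast
    qed auto
  qed
  show ?thesis unfolding pair_in_def Let_def using ind by blast
qed

lemma tuple_in_total: "\<exists>v. tuple_in M zs v"
proof (induction zs)
  case (Cons z zs)
  then show ?case using pair_in_total by (cases zs) (simp, metis tuple_in.simps(3))
qed simp

text \<open>The code pairs a simultaneous solution of the congruences with the number that generates
  the moduli.\<close>

lemma beta_function: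
  assumes F: "definable M (\<lambda>e. F (e 0) (e 1))" and tot: "\<And>i. i \<prec> y \<Longrightarrow> \<exists>v. F i v"
  shows "\<exists>w. \<forall>i. i \<prec> y \<longrightarrow> (\<exists>v. F i v \<and> beta_in M w i v)"
proof -
  have G: "definable M (\<lambda>e. e 0 \<prec> y \<longrightarrow> F (e 0) (e 1))"
    by (intro definable_intros definable_subst2[OF F])
  obtain b where b: "\<zero> \<prec> b" "\<And>i. i \<prec> y \<Longrightarrow> \<exists>v. v \<prec> b \<and> F i v"
    using collection[OF G, of y] tot by blast
  obtain r where r: "\<zero> \<prec> r" "\<And>i. i \<prec> y \<Longrightarrow> \<exists>q. r = (i \<oplus> \<one>) \<otimes> q"
    using common_multiple[of y] by blast
  \<comment> \<open>The factor \<open>b\<close> puts \<open>b \<otimes> r\<close> above suitable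
    values, while \<open>r\<close> makes it divisible by each \<open>i \<oplus> \<one>\<close> with
    \<open>i \<prec> y\<close>.\<close>
  have bd: "\<exists>v. v \<prec> b \<otimes> r \<and> F i v" if "i \<prec> y" for i
    using b(2)[OF that] less_mult_pos[OF r(1)] by blast
  have dv: "\<exists>q. b \<otimes> r = (i \<oplus> \<one>) \<otimes> q" if "i \<prec> y" for i
    using r(2)[OF that] mult.left_commute by metis
  obtain l where
    l: "\<forall>i. i \<prec> y \<longrightarrow> (\<exists>v. F i v \<and> rem_in M l (b \<otimes> r \<otimes> (i \<oplus> \<one>) \<oplus> \<one>) v)"
    using simultaneous_congruences[OF F bd dv mult_pos[OF b(1) r(1)]] by blast
  obtain w where "pair_in M l (b \<otimes> r) w" using pair_in_total by blast
  with l show ?thesis unfolding beta_in_def by blast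
qed

end

section \<open>The relation given by \<open>\<psi>\<close> and its coding\<close>

lemma definable_tuple_code:
  fixes M :: "'a struc"
  assumes fv: "fv \<psi> \<subseteq> {..<length xs + 1 + n}"
  defines "F \<equiv> \<lambda>i v. \<exists>zs. length zs = n \<and> sat M ((!) (xs @ i # zs)) \<psi> \<and> tuple_in M zs v"
  shows "definable M (\<lambda>e. F (e 0) (e 1))"
proof -
  define m where "m = length xs"
  \<comment> \<open>Below \<open>n\<close> quantifiers \<open>i\<close> is \<open>Var n\<close>,
    \<open>v\<close> is \<open>Var (n + 1)\<close>, and the variables for \<open>xs\<close> start at
    index \<open>n + 2\<close>.\<close>
  define p where "p = Exs n (And (inst \<psi> (block (n + 2) m) (Var n) (block 0 n))
    (tuple_fm (block 0 n) (Var (n + 1))))"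
  \<comment> \<open>The entries of \<open>xs\<close> sit behind the two coordinates as parameters,
    with \<open>undefined\<close> as default past their end.\<close>
  define s where "s k = (if k < 2 then Inl k else Inr (bind xs undefined (k - 2)))" for k
  have s: "inst_env s e = case_nat (e 0) (case_nat (e 1) (bind xs undefined))" for e
    by (auto simp: s_def inst_env_def fun_eq_iff numeral_2_eq_2 split: nat.split)
  have bl: "map (val M (bind zs (case_nat i (case_nat v (bind xs c))))) (block (n + 2) m) = xs"
    if "length zs = n" for zs i v c
    using that val_block_bind[of M zs _ 2 m]
    by (simp add: numeral_2_eq_2 val_block_Suc m_def val_block del: add_2_eq_Suc add_2_eq_Suc')
  have vb: "map (val M (bind zs c)) (block 0 n) = zs" if "length zs = n" for zs c
    using that val_block by blast
  have z: "bind zs c n = c 0" "bind zs c (Suc n) = c (Suc 0)" if "length zs = n" for zs :: "'a list" and c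
    using that bind_shift[of zs c 0] bind_shift[of zs c 1] by simp_all
  note bl' = bl[simplified]
  have "F (e 0) (e 1) \<longleftrightarrow> sat M (inst_env s e) p" for e
    using fv
    by (simp add: F_def p_def s sat_Exs sat_inst sat_tuple_fm bl' z m_def[symmetric] vb cong: conj_cong)
  then show ?thesis unfolding definable_def by blast
qed

theorem theorem3p4:
  fixes M :: "'a struc" and \<psi> :: fm and m n :: nat
  assumes "countable (UNIV :: 'a set)"
    and "M \<Turnstile>* PA"
    and "n \<ge> 1"
    and "fv \<psi> \<subseteq> {..<m + 1 + n}"
  shows "M \<Turnstile> coding_sentence m n \<psi>"
  unfolding holds_coding_sentence[OF assms(4)]
proof (intro allI impI)
  fix xs y
  assume m: "length xs = m"
    and unique: "\<forall>i. le_in M i y \<longrightarrow> (\<exists>!zs. length zs = n \<and> sat M ((!) (xs @ i # zs)) \<psi>)"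
  interpret PA_model M by unfold_locales (rule assms(2))
  define F where "F i v \<longleftrightarrow> (\<exists>zs. length zs = n \<and> sat M ((!) (xs @ i # zs)) \<psi> \<and> tuple_in M zs v)" for i v
  have "definable M (\<lambda>e. F (e 0) (e 1))"
    unfolding F_def by (rule definable_tuple_code) (use assms(4) m in simp)
  \<comment> \<open>The lemmas count strictly below a bound, hence \<open>y \<oplus> \<one>\<close>;
    discreteness matches it with \<open>le_in\<close>.\<close>
  moreover have le: "i \<prec> y \<oplus> \<one> \<longleftrightarrow> le_in M i y" for i by (simp add: le_in_def less_Suc_iff)
  have "\<exists>v. F i v" if "i \<prec> y \<oplus> \<one>" for i
    using unique that tuple_in_total unfolding le F_def by blast
  ultimately obtain w where "\<forall>i. le_in M i y \<longrightarrow> (\<exists>v. F i v \<and> beta_in M w i v)"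
    using beta_function[of F "y \<oplus> \<one>"] unfolding le by blast
  \<comment> \<open>The tuple coded by the value found satisfies \<open>\<psi>\<close>, so by
    uniqueness it is the given \<open>zs\<close>.\<close>
  then have "\<exists>v. beta_in M w i v \<and> tuple_in M zs v"
    if "le_in M i y" "length zs = n" "sat M ((!) (xs @ i # zs)) \<psi>" for i zs
    using unique that unfolding F_def by metis
  then show "\<exists>w. \<forall>i. le_in M i y \<longrightarrow> (\<forall>zs. length zs = n \<longrightarrow> sat M ((!) (xs @ i # zs)) \<psi> \<longrightarrow>
      (\<exists>v. beta_in M w i v \<and> tuple_in M zs v))" by blast
qed

end
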